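(* Suppose $m$ and $n$ are positive integers satisfying $n \ge 10^6 m$. If $(R,B)$ is any two-coloring (red/blue) of the edges of the complete graph $K_n$, then either $bs(R) > m$ or $bs(B) \ge n/2 - 2$.
   Context: A two-coloring $(R,B)$ of $E(K_n)$ is a partition of the edges of $K_n$ into red edges and blue edges; $R$ and $B$ denote the spanning graphs on the $n$ vertices formed by the red and blue edges respectively. For a graph $G$, the book size $bs(G)$ is the largest $k$ such that $G$ contains the book $B_k$ (the graph consisting of $k$ triangles sharing a common edge); equivalently, $bs(G)$ is the maximum over edges $uv$ of $G$ of the number of common neighbors of $u$ and $v$ in $G$. *)

theory Defs
  imports Complex_Main "HOL-Library.Ramsey"
begin

text \<open>
  A graph is represented by its edge set, a set of two-element sets of vertices;
  \<^term>\<open>nsets V 2\<close> is the edge set of the complete graph on \<^term>\<open>V\<close>. Isolated vertices are not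
  recorded, since they are irrelevant to containment of books.
\<close>

definition two_coloring :: "'a set \<Rightarrow> 'a set set \<Rightarrow> 'a set set \<Rightarrow> bool" where
  "two_coloring V R B \<longleftrightarrow> R \<union> B = nsets V 2 \<and> R \<inter> B = {}"

text \<open>The triangles \<open>u v w\<close>, for \<^term>\<open>w \<in> W\<close>, on the common edge \<open>u v\<close>.\<close>

definition book_edges :: "'a \<Rightarrow> 'a \<Rightarrow> 'a set \<Rightarrow> 'a set set" where
  "book_edges u v W = {{u, v}} \<union> (\<Union>w\<in>W. {{u, w}, {v, w}})"

definition contains_book :: "'a set set \<Rightarrow> nat \<Rightarrow> bool" where
  "contains_book G k \<longleftrightarrow>
     (\<exists>u v W. u \<noteq> v \<and> u \<notin> W \<and> v \<notin> W \<and> finite W \<and> card W = k \<and> book_edges u v W \<subseteq> G)"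

text \<open>
  The book with no triangles is a single edge, so an edgeless graph contains no book at all;
  inserting \<open>0\<close> gives it book size \<open>0\<close> and changes nothing for other finite graphs.
  For infinite graphs the maximum may not exist.
\<close>

definition book_size :: "'a set set \<Rightarrow> nat" where
  "book_size G = Max (insert 0 {k. contains_book G k})"

end

theory Submission
  imports Defs
begin

text \<open>Suppose that red edges have at most \<open>m\<close> common red neighbours and that
  \<open>N u \<union> N v\<close> has more than \<open>n / 2\<close> elements for every blue edge \<open>u v\<close>, where \<open>N\<close> denotes
  red neighbourhoods. Among five vertices of red degree more than \<open>n / 4\<close>, some pair, which must be
  blue, has a common red neighbourhood \<open>P\<close> of linear size; write \<open>w z\<close> for this pair. The set \<open>S\<close> of
  vertices joined by red to neither \<open>w\<close> nor \<open>z\<close> has fewer than \<open>n / 2\<close> elements, yet up to \<open>O(m)\<close>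
  vertices it contains \<open>N u\<close> for each \<open>u \<in> P\<close>. For blue pairs in \<open>P\<close> the union bound
  then forces the sets \<open>S - N u\<close> to be almost disjoint, so most of them are small. Hence the red graph
  contains an almost complete bipartite graph between large sets \<open>X\<close> and \<open>Y\<close>.

  Split \<open>V\<close> into the vertices \<open>A\<close> without red neighbours in \<open>X\<close>, the other vertices \<open>C\<close> without red
  neighbours in \<open>Y\<close>, and the rest \<open>Z\<close>. Each vertex of \<open>Z\<close> has few red neighbours in \<open>X \<union> Y\<close>, so by
  averaging there is a blue pair in \<open>X\<close> whose red neighbourhoods lie in \<open>C\<close> and at most half of \<open>Z\<close>, and one
  in \<open>Y\<close> whose red neighbourhoods lie in \<open>A\<close> and at most half of \<open>Z\<close>. The two unions then have at
  most \<open>n\<close> elements in total, a contradiction.\<close>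

section \<open>Double counting and almost disjoint families\<close>

text \<open>Count the pairs satisfying \<open>P\<close> in two ways: every dense row holds more than
  \<open>card Z / c\<close> of them, every column at most \<open>k\<close>.\<close>

lemma card_dense_rows_le:
  assumes "finite X" "finite Z"
    and "\<And>z. z \<in> Z \<Longrightarrow> card {x \<in> X. P x z} \<le> k"
  shows "card {x \<in> X. card Z < c * card {z \<in> Z. P x z}} \<le> c * k"
proof (cases "Z = {}")
  case True
  then show ?thesis by simp
next
  case False
  define D where "D = {x \<in> X. card Z < c * card {z \<in> Z. P x z}}"
  have D: "finite D" "D \<subseteq> X"
    using assms(1) by (auto simp: D_def)
  have "card Z * card D = (\<Sum>x\<in>D. card Z)"
    by simp
  also have "\<dots> \<le> (\<Sum>x\<in>D. c * card {z \<in> Z. P x z})"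
    by (rule sum_mono) (auto simp: D_def)
  also have "\<dots> = c * (\<Sum>x\<in>D. card {z \<in> Z. P x z})"
    by (simp add: sum_distrib_left)
  also have "(\<Sum>x\<in>D. card {z \<in> Z. P x z}) = (\<Sum>z\<in>Z. card {x \<in> D. P x z})"
    using sum.swap_restrict[OF D(1) assms(2), of "\<lambda>_ _. 1::nat" P] by simp
  also have "\<dots> \<le> (\<Sum>z\<in>Z. k)"
  proof (rule sum_mono)
    fix z assume "z \<in> Z"
    have "card {x \<in> D. P x z} \<le> card {x \<in> X. P x z}"
      using D(2) assms(1) by (intro card_mono) auto
    with assms(3)[OF \<open>z \<in> Z\<close>] show "card {x \<in> D. P x z} \<le> k"
      by simp
  qed
  also have "c * (\<Sum>z\<in>Z. k) = card Z * (c * k)"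
    by simp
  finally have "card Z * card D \<le> card Z * (c * k)"
    by simp
  moreover have "card Z > 0"
    using False assms(2) by (simp add: card_gt_0_iff)
  ultimately show ?thesis
    by (simp add: D_def)
qed

text \<open>Adding the sets one at a time, each new one meets the union of the earlier ones in at
  most \<open>c\<close> elements per earlier set; \<open>card I * card I\<close> is a crude count of
  the pairs.\<close>

lemma sum_card_almost_disjoint_le:
  assumes "finite I" "finite S"
    and "\<And>i. i \<in> I \<Longrightarrow> D i \<subseteq> S"
    and "\<And>i j. i \<in> I \<Longrightarrow> j \<in> I \<Longrightarrow> i \<noteq> j \<Longrightarrow> card (D i \<inter> D j) \<le> c"
  shows "(\<Sum>i\<in>I. card (D i)) \<le> card S + card I * card I * c"
proof -
  have "(\<Sum>i\<in>I. card (D i)) \<le> card (\<Union>i\<in>I. D i) + card I * card I * c"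
    using assms(1,3,4)
  proof (induction I rule: finite_induct)
    case empty
    then show ?case by simp
  next
    case (insert i I)
    let ?U = "\<Union>j\<in>I. D j"
    have fin: "finite ?U" "finite (D i)"
      using insert.prems(1) insert.hyps(1) assms(2) by (auto intro: finite_subset)
    have "card (D i \<inter> ?U) \<le> (\<Sum>j\<in>I. card (D i \<inter> D j))"
      using card_UN_le[OF insert.hyps(1), of "\<lambda>j. D i \<inter> D j"] by simp
    also have "\<dots> \<le> (\<Sum>j\<in>I. c)"
      using insert.prems(2) insert.hyps(2) by (intro sum_mono) auto
    finally have *: "card (D i \<inter> ?U) \<le> card I * c"
      by simp
    have IH: "(\<Sum>j\<in>I. card (D j)) \<le> card ?U + card I * card I * c"
      using insert.IH insert.prems by blast
    have "card (D i) + card ?U = card (D i \<union> ?U) + card (D i \<inter> ?U)"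
      using card_Un_Int[OF fin(2) fin(1)] .
    with * IH have "card (D i) + (\<Sum>j\<in>I. card (D j))
        \<le> card (D i \<union> ?U) + (card I * c + card I * card I * c)"
      by linarith
    also have "card I * c + card I * card I * c \<le> Suc (card I) * Suc (card I) * c"
      by (simp add: add_mult_distrib)
    finally show ?case
      using insert.hyps by simp
  qed
  moreover have "card (\<Union>i\<in>I. D i) \<le> card S"
    using assms(2,3) by (intro card_mono) auto
  ultimately show ?thesis
    by simp
qed

lemma two_elements:
  assumes "card A \<ge> 2"
  obtains x y where "x \<in> A" "y \<in> A" "x \<noteq> y"
proof -
  obtain T where "T \<subseteq> A" "card T = 2"
    using obtain_subset_with_card_n[OF assms] by blast
  then show thesis
    using that by (auto simp: card_2_iff)
qed

text \<open>Here \<open>N v\<close> is the red neighbourhood of \<open>v\<close>. The second inequality restates that a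
  blue edge has fewer than \<open>n / 2 - 2\<close> common blue neighbours, since there are
  \<open>n - 2 - card (N u \<union> N v)\<close> of them.\<close>

locale bookless_coloring =
  fixes V :: "'a set" and N :: "'a \<Rightarrow> 'a set" and m :: nat
  assumes fin_V: "finite V"
    and N_subset: "N v \<subseteq> V"
    and N_sym: "u \<in> N v \<Longrightarrow> v \<in> N u"
    and N_irrefl: "v \<notin> N v"
    and red_codegree: "u \<in> N v \<Longrightarrow> card (N u \<inter> N v) \<le> m"
    and blue_union: "u \<in> V \<Longrightarrow> v \<in> V \<Longrightarrow> u \<noteq> v \<Longrightarrow> u \<notin> N v \<Longrightarrow>
      card V < 2 * card (N u \<union> N v)"
begin

lemma fin_N [simp]: "finite (N v)"
  using N_subset fin_V by (rule finite_subset)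

lemma red_codegree': "v \<in> N u \<Longrightarrow> card (N u \<inter> N v) \<le> m"
  using red_codegree N_sym by blast

section \<open>Almost complete bipartite red graphs\<close>

text \<open>The ends of a red edge inside \<open>X\<close> would share all but \<open>2 * s\<close>
  vertices of \<open>Y\<close>, more than \<open>m\<close>.\<close>

lemma near_complete_independent:
  assumes "Y \<subseteq> V" "\<And>x. x \<in> X \<Longrightarrow> card (Y - N x) \<le> s"
    and "2 * s + m < card Y" "x \<in> X"
  shows "N x \<inter> X = {}"
proof (rule ccontr)
  assume "N x \<inter> X \<noteq> {}"
  then obtain x' where x': "x' \<in> X" "x' \<in> N x"
    by auto
  have fin: "finite Y"
    using assms(1) fin_V by (rule finite_subset)
  have "card Y \<le> card ((Y - N x) \<union> (Y - N x') \<union> (N x \<inter> N x'))"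
    using fin by (intro card_mono) auto
  also have "\<dots> \<le> card (Y - N x) + card (Y - N x') + card (N x \<inter> N x')"
    by (meson card_Un_le order_trans add_right_mono)
  also have "\<dots> \<le> s + s + m"
    using assms(2)[OF assms(4)] assms(2)[OF x'(1)] red_codegree'[OF x'(2)] by linarith
  finally show False
    using assms(3) by simp
qed

text \<open>For a red neighbour \<open>x\<close> of \<open>z\<close> in \<open>X\<close>, a vertex
  of \<open>N z \<inter> Y\<close> is either one of the few missed by \<open>x\<close> or a common
  red neighbour of \<open>x\<close> and \<open>z\<close>.\<close>

lemma low_degree_bound:
  assumes "Y \<subseteq> V" "\<And>x. x \<in> X \<Longrightarrow> card (Y - N x) \<le> s" "N z \<inter> X \<noteq> {}"
  shows "card (N z \<inter> Y) \<le> s + m"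
proof -
  obtain x where x: "x \<in> X" "x \<in> N z"
    using assms(3) by auto
  have fin: "finite Y"
    using assms(1) fin_V by (rule finite_subset)
  have "card (N z \<inter> Y) \<le> card ((Y - N x) \<union> (N z \<inter> N x))"
    using fin by (intro card_mono) auto
  also have "\<dots> \<le> card (Y - N x) + card (N z \<inter> N x)"
    by (rule card_Un_le)
  also have "\<dots> \<le> s + m"
    using assms(2)[OF x(1)] red_codegree'[OF x(2)] by linarith
  finally show ?thesis .
qed

text \<open>At most \<open>4 * k\<close> vertices of \<open>X\<close> are joined by red to more than
  a quarter of \<open>Z\<close>. Two others form a blue pair, and their red neighbourhoods cover at
  most \<open>C\<close> and half of \<open>Z\<close>.\<close>

lemma blue_union_le_average:
  assumes "X \<subseteq> V" "\<And>x. x \<in> X \<Longrightarrow> N x \<inter> X = {}"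
    and "\<And>x. x \<in> X \<Longrightarrow> N x \<subseteq> C \<union> Z" "C \<subseteq> V" "Z \<subseteq> V"
    and "\<And>z. z \<in> Z \<Longrightarrow> card (N z \<inter> X) \<le> k"
    and "4 * k + 2 \<le> card X"
  shows "card V < 2 * card C + card Z"
proof -
  have fin: "finite X" "finite C" "finite Z"
    using assms fin_V by (auto intro: finite_subset)
  define Q where "Q = {x \<in> X. card Z < 4 * card {z \<in> Z. z \<in> N x}}"
  have "card {x \<in> X. z \<in> N x} \<le> k" if "z \<in> Z" for z
  proof -
    have "{x \<in> X. z \<in> N x} = N z \<inter> X"
      using N_sym by auto
    then show ?thesis
      using assms(6)[OF that] by simp
  qed
  then have "card Q \<le> 4 * k"
    unfolding Q_def by (rule card_dense_rows_le[OF fin(1,3)])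
  then have "card (X - Q) \<ge> 2"
    using assms(7) diff_card_le_card_Diff[of Q X] fin(1) by (simp add: Q_def)
  then obtain x y where xy: "x \<in> X - Q" "y \<in> X - Q" "x \<noteq> y"
    by (rule two_elements)
  have few: "4 * card {z \<in> Z. z \<in> N v} \<le> card Z" if "v \<in> X - Q" for v
    using that by (auto simp: Q_def)
  have "card V < 2 * card (N x \<union> N y)"
    using xy assms(1,2) by (intro blue_union) auto
  moreover have "card (N x \<union> N y) \<le> card (C \<union> {z \<in> Z. z \<in> N x} \<union> {z \<in> Z. z \<in> N y})"
    using xy assms(3) fin by (intro card_mono) auto
  moreover have "card (C \<union> {z \<in> Z. z \<in> N x} \<union> {z \<in> Z. z \<in> N y})
      \<le> card C + card {z \<in> Z. z \<in> N x} + card {z \<in> Z. z \<in> N y}"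
    by (meson card_Un_le order_trans add_right_mono)
  ultimately show ?thesis
    using few[OF xy(1)] few[OF xy(2)] by linarith
qed

lemma near_complete_bipartite_False:
  assumes "X \<subseteq> V" "Y \<subseteq> V"
    and X: "\<And>x. x \<in> X \<Longrightarrow> card (Y - N x) \<le> s"
    and Y: "\<And>y. y \<in> Y \<Longrightarrow> card (X - N y) \<le> t"
    and cX: "4 * (t + m) + 2 \<le> card X"
    and cY: "4 * (s + m) + 2 \<le> card Y"
  shows False
proof -
  have indX: "N x \<inter> X = {}" if "x \<in> X" for x
    using near_complete_independent[OF assms(2) X _ that] cY by simp
  have indY: "N y \<inter> Y = {}" if "y \<in> Y" for y
    using near_complete_independent[OF assms(1) Y _ that] cX by simp
  define A where "A = {z \<in> V. N z \<inter> X = {}}"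
  define C where "C = {z \<in> V. N z \<inter> Y = {}} - A"
  define Z where "Z = V - A - C"
  have sub: "A \<subseteq> V" "C \<subseteq> V" "Z \<subseteq> V"
    by (auto simp: A_def C_def Z_def)
  have "N x \<subseteq> C \<union> Z" if "x \<in> X" for x
    using that N_subset[of x] N_sym[of _ x] by (auto simp: A_def Z_def)
  \<comment> \<open>The roles cross: a red neighbour of \<open>z\<close> in \<open>Y\<close>, which
    exists as \<open>z\<close> lies outside \<open>A\<close> and \<open>C\<close>, limits the red
    neighbours of \<open>z\<close> in \<open>X\<close>.\<close>
  moreover have "card (N z \<inter> X) \<le> t + m" if "z \<in> Z" for z
    using that by (intro low_degree_bound[OF assms(1) Y]) (auto simp: A_def C_def Z_def)
  ultimately have 1: "card V < 2 * card C + card Z"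
    using cX by (intro blue_union_le_average[OF assms(1) indX _ sub(2,3)]) auto
  have "N y \<subseteq> A \<union> Z" if "y \<in> Y" for y
    using that N_subset[of y] N_sym[of _ y] by (auto simp: C_def Z_def)
  moreover have "card (N z \<inter> Y) \<le> s + m" if "z \<in> Z" for z
    using that by (intro low_degree_bound[OF assms(2) X]) (auto simp: A_def C_def Z_def)
  ultimately have 2: "card V < 2 * card A + card Z"
    using cY by (intro blue_union_le_average[OF assms(2) indY _ sub(1,3)]) auto
  have "card A + card C = card (A \<union> C)"
    using sub fin_V by (intro card_Un_disjoint[symmetric])
      (auto simp: C_def intro: finite_subset)
  moreover have "card Z = card V - card (A \<union> C)"
    using sub fin_V card_Diff_subset[of "A \<union> C" V]
    by (simp add: Z_def Diff_eq Int_assoc finite_subset)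
  moreover have "card (A \<union> C) \<le> card V"
    using sub fin_V by (intro card_mono) auto
  ultimately show False
    using 1 2 by linarith
qed

section \<open>Blue cliques and a blue pair of large red codegree\<close>

text \<open>Greedy choice: each chosen vertex rules out itself and at most \<open>m\<close> red
  neighbours.\<close>

lemma ex_independent_subset:
  assumes "finite Q" "\<And>u. u \<in> Q \<Longrightarrow> card (N u \<inter> Q) \<le> m" "k * (m + 1) \<le> card Q"
  shows "\<exists>T \<subseteq> Q. card T = k \<and> (\<forall>u\<in>T. \<forall>v\<in>T. u \<notin> N v)"
  using assms(3)
proof (induction k)
  case 0
  then show ?case by (intro exI[of _ "{}"]) simp
next
  case (Suc k)
  then obtain T where T: "T \<subseteq> Q" "card T = k" "\<forall>u\<in>T. \<forall>v\<in>T. u \<notin> N v"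
    by auto
  have fT: "finite T"
    using T(1) assms(1) by (rule finite_subset)
  let ?U = "\<Union>u\<in>T. insert u (N u \<inter> Q)"
  have "card ?U \<le> (\<Sum>u\<in>T. card (insert u (N u \<inter> Q)))"
    by (rule card_UN_le[OF fT])
  also have "\<dots> \<le> (\<Sum>u\<in>T. m + 1)"
  proof (rule sum_mono)
    fix u assume "u \<in> T"
    then show "card (insert u (N u \<inter> Q)) \<le> m + 1"
      using assms(2)[of u] T(1) card_insert_le_m1[of "m + 1" "N u \<inter> Q" u] by auto
  qed
  also have "\<dots> = k * (m + 1)"
    using T(2) by simp
  also have "\<dots> < card Q"
    using Suc.prems by simp
  finally have "\<not> Q \<subseteq> ?U"
    using card_mono[of ?U Q] fT assms(1) by fastforce
  then obtain v where v: "v \<in> Q" "v \<notin> ?U"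
    by blast
  have "card (insert v T) = Suc k"
    using v T(2) fT by auto
  moreover have "\<forall>u\<in>insert v T. \<forall>w\<in>insert v T. u \<notin> N w"
    using v T(1,3) N_sym[of _ v] N_irrefl by auto
  ultimately show ?case
    using v T(1) by (intro exI[of _ "insert v T"]) auto
qed

lemma ex_blue_large_codegree:
  assumes "m > 0" "1000000 * m \<le> card V"
  shows "\<exists>w\<in>V. \<exists>z\<in>V. w \<noteq> z \<and> w \<notin> N z \<and> card V < 500 * card (N w \<inter> N z)"
proof (rule ccontr)
  assume no: "\<not> ?thesis"
  \<comment> \<open>Red pairs obey the same bound, since their codegree is at most
    \<open>m\<close>.\<close>
  have codeg: "500 * card (N w \<inter> N z) \<le> card V" if "w \<in> V" "z \<in> V" "w \<noteq> z" for w z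
  proof (cases "w \<in> N z")
    case True
    then show ?thesis
      using red_codegree[OF True] assms by simp
  next
    case False
    then show ?thesis
      using no that by (meson not_le)
  qed
  define H where "H = {v \<in> V. card V < 4 * card (N v)}"
  \<comment> \<open>If some \<open>v\<close> has red degree at most \<open>card V / 4\<close>, the
    union bound puts all blue neighbours of \<open>v\<close> into \<open>H\<close>, about three
    quarters of \<open>V\<close> or more.\<close>
  have "5 \<le> card H"
  proof (cases "H = V")
    case True
    then show ?thesis using assms by simp
  next
    case False
    then obtain v where "v \<in> V" "v \<notin> H"
      unfolding H_def by blast
    then have v: "v \<in> V" "4 * card (N v) \<le> card V"
      by (auto simp: H_def)
    have "V - insert v (N v) \<subseteq> H"
    proof
      fix u assume u: "u \<in> V - insert v (N v)"
      then have "card V < 2 * card (N u \<union> N v)"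
        using v(1) by (intro blue_union) auto
      with v(2) card_Un_le[of "N u" "N v"] have "card V < 4 * card (N u)"
        by linarith
      then show "u \<in> H"
        using u by (simp add: H_def)
    qed
    then have "card (V - insert v (N v)) \<le> card H"
      using fin_V by (intro card_mono) (auto simp: H_def)
    moreover have "card V - card (insert v (N v)) \<le> card (V - insert v (N v))"
      by (intro diff_card_le_card_Diff) simp
    moreover have "card (insert v (N v)) \<le> card (N v) + 1"
      by (simp add: card_insert_if)
    ultimately show ?thesis
      using v(2) assms by linarith
  qed
  then obtain I where I: "I \<subseteq> H" "card I = 5" "finite I"
    by (meson obtain_subset_with_card_n)
  have "card (N w \<inter> N z) \<le> card V div 500" if "w \<in> I" "z \<in> I" "w \<noteq> z" for w z
    using codeg[of w z] that I(1) by (auto simp: H_def less_eq_div_iff_mult_less_eq mult.commute)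
  then have "(\<Sum>v\<in>I. card (N v)) \<le> card V + card I * card I * (card V div 500)"
    using I(3) fin_V N_subset by (intro sum_card_almost_disjoint_le) auto
  moreover have "(\<Sum>v\<in>I. card V div 4) \<le> (\<Sum>v\<in>I. card (N v))"
    using I(1) by (intro sum_mono) (auto simp: H_def)
  \<comment> \<open>Up to rounding, the left side is \<open>1.25 * card V\<close> and the right side
    at most \<open>1.05 * card V\<close>.\<close>
  ultimately have "5 * (card V div 4) \<le> card V + 25 * (card V div 500)"
    by (simp add: I(2))
  then show False
    using assms by linarith
qed

section \<open>Extraction of the almost complete bipartite graph\<close>

lemma large_False:
  assumes "m > 0" "1000000 * m \<le> card V"
  shows False
proof -
  obtain w z where wz: "w \<in> V" "z \<in> V" "w \<noteq> z" "w \<notin> N z"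
    and large: "card V < 500 * card (N w \<inter> N z)"
    using ex_blue_large_codegree[OF assms] by blast
  define P where "P = N w \<inter> N z"
  define S where "S = V - (N w \<union> N z)"
  have fin: "finite P" "finite S"
    using fin_V by (auto simp: P_def S_def)
  have sub: "P \<subseteq> V" "S \<subseteq> V"
    using N_subset by (auto simp: P_def S_def)
  have cS: "2 * card S < card V"
    using blue_union[OF wz] N_subset card_Diff_subset[of "N w \<union> N z" V]
      assms
    unfolding S_def by simp
  \<comment> \<open>Both \<open>u w\<close> and \<open>u z\<close> are red, and a vertex of
    \<open>N u\<close> outside \<open>S\<close> is a common red neighbour along one of them.\<close>
  have leave: "card (N u - S) \<le> 2 * m" if "u \<in> P" for u
  proof -
    have "card (N u - S) \<le> card ((N u \<inter> N w) \<union> (N u \<inter> N z))"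
      using N_subset by (intro card_mono) (auto simp: S_def)
    also have "\<dots> \<le> card (N u \<inter> N w) + card (N u \<inter> N z)"
      by (rule card_Un_le)
    also have "\<dots> \<le> 2 * m"
      using red_codegree[of u w] red_codegree[of u z] that by (auto simp: P_def)
    finally show ?thesis .
  qed
  have cover: "card V < 2 * card (S \<inter> (N u \<union> N v)) + 8 * m"
    if "u \<in> P" "v \<in> P" "u \<noteq> v" "u \<notin> N v" for u v
  proof -
    have "card V < 2 * card (N u \<union> N v)"
      using that sub by (intro blue_union) auto
    moreover have "card (N u \<union> N v) \<le> card ((S \<inter> (N u \<union> N v)) \<union> (N u - S) \<union> (N v - S))"
      by (intro card_mono) auto
    moreover have "\<dots> \<le> card (S \<inter> (N u \<union> N v)) + card (N u - S) + card (N v - S)"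
      by (meson card_Un_le order_trans add_right_mono)
    ultimately show ?thesis
      using leave[OF that(1)] leave[OF that(2)] by linarith
  qed
  have almost_disjoint: "card ((S - N u) \<inter> (S - N v)) \<le> 4 * m"
    if "u \<in> P" "v \<in> P" "u \<noteq> v" "u \<notin> N v" for u v
  proof -
    have "card S = card (S \<inter> (N u \<union> N v)) + card ((S - N u) \<inter> (S - N v))"
      using fin(2) by (subst card_Un_disjoint[symmetric]) (auto intro: arg_cong[of _ _ card])
    then show ?thesis
      using cover[OF that] cS by linarith
  qed
  have deg_P: "card (N u \<inter> P) \<le> m" if "u \<in> P" for u
  proof -
    have "card (N u \<inter> P) \<le> card (N u \<inter> N w)"
      by (intro card_mono) (auto simp: P_def)
    then show ?thesis
      using red_codegree[of u w] that by (simp add: P_def)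
  qed
  \<comment> \<open>This makes \<open>500 * (s + 1)\<close> exceed \<open>1.5 * card V\<close>,
    whereas 500 pairwise blue vertices of \<open>Q\<close> allow at most
    \<open>card S + 500 * 500 * (4 * m)\<close>, where \<open>card S\<close> is below
    \<open>card V / 2\<close> and the last term is at most \<open>card V\<close>.\<close>
  define s where "s = 3 * card V div 1000"
  have s: "1000 * s \<le> 3 * card V" "3 * card V < 1000 * s + 1000"
    using div_mult_mod_eq[of "3 * card V" 1000] mod_less_divisor[of 1000 "3 * card V"]
    unfolding s_def by linarith+
  define Q where "Q = {u \<in> P. s < card (S - N u)}"
  have "card Q < 500 * (m + 1)"
  proof (rule ccontr)
    assume "\<not> card Q < 500 * (m + 1)"
    moreover have "card (N u \<inter> Q) \<le> m" if "u \<in> Q" for u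
    proof -
      have "card (N u \<inter> Q) \<le> card (N u \<inter> P)"
        by (intro card_mono) (auto simp: Q_def)
      then show ?thesis
        using deg_P[of u] that by (simp add: Q_def)
    qed
    moreover have "finite Q"
      using fin(1) by (simp add: Q_def)
    ultimately obtain T where T: "T \<subseteq> Q" "card T = 500" "\<forall>u\<in>T. \<forall>v\<in>T. u \<notin> N v"
      using ex_independent_subset[of Q 500] by auto
    have TP: "T \<subseteq> P" "finite T"
      using T(1) fin(1) by (auto simp: Q_def intro: finite_subset)
    have "(\<Sum>u\<in>T. card (S - N u)) \<le> card S + card T * card T * (4 * m)"
      using TP fin(2) T(3) by (intro sum_card_almost_disjoint_le almost_disjoint) auto
    moreover have "(\<Sum>u\<in>T. s + 1) \<le> (\<Sum>u\<in>T. card (S - N u))"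
      using T(1) by (intro sum_mono) (auto simp: Q_def)
    ultimately have "500 * (s + 1) \<le> card S + 1000000 * m"
      by (simp add: T(2))
    then show False
      using cS s assms by simp
  qed
  define X where "X = P - Q"
  have X: "X \<subseteq> P" "finite X"
    using fin(1) by (auto simp: X_def)
  have "card P - card Q \<le> card X"
    unfolding X_def using fin(1) by (intro diff_card_le_card_Diff) (simp add: Q_def)
  with \<open>card Q < _\<close> large have cX: "1000 * m \<le> card X"
    using assms unfolding P_def by simp
  \<comment> \<open>With the threshold 1/8, the term \<open>4 * t\<close> required later is at most
    half of \<open>card X\<close>, and only \<open>8 * s\<close> vertices of \<open>S\<close>, about
    2.4 percent of \<open>V\<close>, are lost.\<close>
  define Y where "Y = {y \<in> S. 8 * card {x \<in> X. y \<notin> N x} \<le> card X}"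
  have miss: "card (S - N x) \<le> s" if "x \<in> X" for x
    using that by (auto simp: X_def Q_def)
  have "card {y \<in> S. card X < 8 * card {x \<in> X. y \<notin> N x}} \<le> 8 * s"
    using fin(2) X(2) miss by (intro card_dense_rows_le) (auto simp: set_diff_eq)
  moreover have "card S = card Y + card {y \<in> S. card X < 8 * card {x \<in> X. y \<notin> N x}}"
    using fin(2) unfolding Y_def
    by (subst card_Un_disjoint[symmetric]) (auto intro: arg_cong[of _ _ card])
  \<comment> \<open>A blue pair in \<open>P\<close> shows that \<open>S\<close> has nearly half of
    all vertices, so \<open>Y\<close> stays large.\<close>
  moreover have "card V < 2 * card S + 8 * m"
  proof -
    have "2 * (m + 1) \<le> card P"
      using large assms unfolding P_def by simp
    then obtain T where T: "T \<subseteq> P" "card T = 2" "\<forall>u\<in>T. \<forall>v\<in>T. u \<notin> N v"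
      using ex_independent_subset[of P 2] fin(1) deg_P by auto
    obtain u v where uv: "u \<in> T" "v \<in> T" "u \<noteq> v"
      using two_elements[of T] T(2) by auto
    have "card V < 2 * card (S \<inter> (N u \<union> N v)) + 8 * m"
      using uv T by (intro cover) auto
    moreover have "card (S \<inter> (N u \<union> N v)) \<le> card S"
      using fin(2) by (intro card_mono) auto
    ultimately show ?thesis
      by linarith
  qed
  ultimately have cY: "4 * (s + m) + 2 \<le> card Y"
    using s assms by simp
  have "card (Y - N x) \<le> s" if "x \<in> X" for x
  proof -
    have "card (Y - N x) \<le> card (S - N x)"
      using fin(2) by (intro card_mono) (auto simp: Y_def)
    then show ?thesis
      using miss[OF that] by simp
  qed
  moreover have "card (X - N y) \<le> card X div 8" if "y \<in> Y" for y
  proof -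
    have "X - N y = {x \<in> X. y \<notin> N x}"
      using N_sym by auto
    then show ?thesis
      using that by (auto simp: Y_def)
  qed
  moreover have "4 * (card X div 8 + m) + 2 \<le> card X"
    using cX assms(1) by simp
  moreover have "X \<subseteq> V" "Y \<subseteq> V"
    using X(1) sub by (auto simp: Y_def)
  ultimately show False
    using near_complete_bipartite_False[of X Y s "card X div 8"] cY by blast
qed

end

section \<open>Book sizes and the passage to red neighbourhoods\<close>

text \<open>The pages of a book are indexed by vertices in \<open>\<Union>G\<close>, so the maximum
  is taken over a finite set.\<close>

lemma contains_book_le_book_size:
  assumes "finite (\<Union>G)" "contains_book G k"
  shows "k \<le> book_size G"
proof -
  have "j \<le> card (\<Union>G)" if "contains_book G j" for j
  proof -
    from that obtain u v W where W: "card W = j" "book_edges u v W \<subseteq> G"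
      unfolding contains_book_def by blast
    have "W \<subseteq> \<Union>G"
    proof
      fix w assume "w \<in> W"
      then have "{u, w} \<in> G"
        using W(2) by (auto simp: book_edges_def)
      then show "w \<in> \<Union>G" by blast
    qed
    then show ?thesis
      using W(1) assms(1) card_mono by blast
  qed
  then have "{k. contains_book G k} \<subseteq> {..card (\<Union>G)}"
    by auto
  then have "finite {k. contains_book G k}"
    by (rule finite_subset) simp
  then show ?thesis
    using assms(2) unfolding book_size_def by (intro Max_ge) auto
qed

lemma common_neighbours_le_book_size:
  assumes "finite (\<Union>G)" "{u, v} \<in> G" "u \<noteq> v" "finite W" "u \<notin> W" "v \<notin> W"
    and "\<And>w. w \<in> W \<Longrightarrow> {u, w} \<in> G \<and> {v, w} \<in> G"
  shows "card W \<le> book_size G"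
proof (rule contains_book_le_book_size[OF assms(1)])
  have "book_edges u v W \<subseteq> G"
    using assms(2,7) by (auto simp: book_edges_def)
  then show "contains_book G (card W)"
    unfolding contains_book_def using assms(3-6) by blast
qed

theorem theorem6:
  fixes m n :: nat and V :: "'a set" and R B :: "'a set set"
  assumes "m > 0" and "n > 0" and "n \<ge> 10 ^ 6 * m"
    and "finite V" and "card V = n"
    and "two_coloring V R B"
  shows "book_size R > m \<or> real (book_size B) \<ge> real n / 2 - 2"
proof (rule ccontr)
  assume "\<not> ?thesis"
  then have bs: "book_size R \<le> m" "real (book_size B) < real n / 2 - 2"
    by auto
  have edge: "{u, v} \<in> R \<union> B \<longleftrightarrow> u \<in> V \<and> v \<in> V \<and> u \<noteq> v" for u v
    using assms(6) by (auto simp: two_coloring_def nsets_def card_insert_if)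
  have "\<Union>(R \<union> B) \<subseteq> V"
    using assms(6) by (auto simp: two_coloring_def nsets_def)
  then have fin: "finite (\<Union>R)" "finite (\<Union>B)"
    using assms(4) by (auto intro: finite_subset)
  define N where "N v = {u. {u, v} \<in> R}" for v
  have NV: "N v \<subseteq> V - {v}" for v
    using edge by (auto simp: N_def)
  have finN: "finite (N v)" for v
    using NV assms(4) by (meson finite_Diff finite_subset)
  interpret bookless_coloring V N m
  proof
    show "finite V" by fact
    show "N v \<subseteq> V" "v \<notin> N v" for v
      using NV by auto
    show "v \<in> N u" if "u \<in> N v" for u v
      using that by (simp add: N_def insert_commute)
    show "card (N u \<inter> N v) \<le> m" if "u \<in> N v" for u v
    proof -
      have "card (N u \<inter> N v) \<le> book_size R"
      proof (rule common_neighbours_le_book_size[OF fin(1)])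
        show "{u, v} \<in> R"
          using that by (simp add: N_def)
        show "u \<noteq> v" "u \<notin> N u \<inter> N v" "v \<notin> N u \<inter> N v" "finite (N u \<inter> N v)"
          using that NV finN by auto
        show "{u, w} \<in> R \<and> {v, w} \<in> R" if "w \<in> N u \<inter> N v" for w
          using that by (simp add: N_def insert_commute)
      qed
      with bs(1) show ?thesis by simp
    qed
    show "card V < 2 * card (N u \<union> N v)"
      if uv: "u \<in> V" "v \<in> V" "u \<noteq> v" "u \<notin> N v" for u v
    proof -
      \<comment> \<open>The vertices of \<open>V\<close> outside \<open>?M\<close> are the common
        blue neighbours of \<open>u\<close> and \<open>v\<close>.\<close>
      let ?M = "insert u (insert v (N u \<union> N v))"
      have nin: "u \<notin> N v" "v \<notin> N u" "u \<notin> N u" "v \<notin> N v"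
        using uv(4) NV[of u] NV[of v] by (blast, simp add: N_def insert_commute, blast+)
      have blue: "{a, b} \<in> B" if "a \<in> V" "b \<in> V" "a \<noteq> b" "b \<notin> N a" for a b
        using edge[of a b] that by (auto simp: N_def insert_commute)
      have "card (V - ?M) \<le> book_size B"
        using uv nin assms(4)
        by (intro common_neighbours_le_book_size[OF fin(2), of u v]) (auto intro!: blue)
      moreover have "card V = card (V - ?M) + card ?M"
        using uv NV assms(4) finN by (subst card_Un_disjoint[symmetric])
          (auto intro!: arg_cong[of _ _ card])
      moreover have "card ?M = card (N u \<union> N v) + 2"
        using uv nin finN by simp
      ultimately have "real (card V) - 2 - real (card (N u \<union> N v)) < real n / 2 - 2"
        using bs(2) by linarith
      then show ?thesis
        using assms(5) by linarith
    qed
  qed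
  show False
    using large_False assms(1,3,5) by simp
qed

end
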